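(* Let $X$ be a Poisson random variable with mean $\lambda>0$, let $X_1,X_2,\dots$ be i.i.d. samples of $X$, let $\gamma$ and $n$ be positive integers, and let $\mathbf{n}$ and $\widehat{\lambda}$ be the number of samples and the estimator of truncated inverse sampling with threshold $\gamma$ and maximum sample size $n$ (see context). Let $0<\delta<1$. Define the lower confidence limit $\underline{\lambda}$ such that $\underline{\lambda}=0$ for $\widehat{\lambda}=0$, $$\sum_{i=\gamma}^{\infty}\frac{1}{i!}(\mathbf{n}\underline{\lambda})^i\exp(-\mathbf{n}\underline{\lambda})=\frac{\delta}{2}\quad\text{for }\widehat{\lambda}\ge\frac{\gamma}{n},$$ and $$\sum_{i=\mathbf{k}}^{\infty}\frac{1}{i!}(n\underline{\lambda})^i\exp(-n\underline{\lambda})=\frac{\delta}{2}\quad\text{for }0<\widehat{\lambda}<\frac{\gamma}{n},$$ where $\mathbf{k}=\sum_{i=1}^{n}X_i$ in the latter case. Define the upper confidence limit $\overline{\lambda}$ (the cases being read in the order listed) such that $\overline{\lambda}=\infty$ for $\mathbf{n}=1$, $$\sum_{i=0}^{\gamma-1}\frac{1}{i!}[(\mathbf{n}-1)\overline{\lambda}]^i\exp(-(\mathbf{n}-1)\overline{\lambda})=\frac{\delta}{2}\quad\text{for }\frac{\gamma}{n}\le\widehat{\lambda}<\gamma,$$ and $$\sum_{i=0}^{\mathbf{k}}\frac{1}{i!}(n\overline{\lambda})^i\exp(-n\overline{\lambda})=\frac{\delta}{2}\quad\text{for }\widehat{\lambda}<\frac{\gamma}{n}.$$ Then $\Pr\{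\underline{\lambda}<\lambda<\overline{\lambda}\}\ge1-\delta$.
   Context: Truncated inverse sampling with threshold $\gamma$ and maximum sample size $n$: sampling continues until the sample sum is no less than $\gamma$ or the number of samples reaches $n$. Thus $\mathbf{n}=\min\{n,\ \min\{\ell\in\mathbb{N}:\sum_{i=1}^{\ell}X_i\ge\gamma\}\}$ (minimum of the empty set is $+\infty$), $\mathbf{k}=\sum_{i=1}^{\mathbf{n}}X_i$, and $\widehat{\lambda}=\min\{\mathbf{k},\gamma\}/\mathbf{n}$. Note that $\mathbf{n}$ (random) and $n$ (deterministic maximum sample size) are different. The limits $\underline{\lambda}\in[0,\infty)$ and $\overline{\lambda}\in[0,\infty]$ are random variables, being functions of the observed data. *)

theory Defs
  imports "HOL-Probability.Probability" "HOL-Library.Extended_Nat"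
begin

text \<open>
  Truncated inverse sampling with threshold \<open>\<gamma>\<close> and maximum sample size \<open>n\<close>.
  The samples are \<open>X 1, X 2, \<dots>\<close>; the value \<open>X 0\<close> plays no role.
\<close>

definition sample_sum :: "(nat \<Rightarrow> 'a \<Rightarrow> nat) \<Rightarrow> nat \<Rightarrow> 'a \<Rightarrow> nat" where
  "sample_sum X l \<omega> = (\<Sum>i=1..l. X i \<omega>)"

text \<open>
  Taking the infimum in \<^typ>\<open>enat\<close> gives \<open>\<infinity>\<close> when the threshold is never reached; the outer
  minimum is always finite.
\<close>

definition sample_size :: "(nat \<Rightarrow> 'a \<Rightarrow> nat) \<Rightarrow> nat \<Rightarrow> nat \<Rightarrow> 'a \<Rightarrow> nat" where
  "sample_size X \<gamma> n \<omega> =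
     the_enat (min (enat n) (INF l \<in> {l. 1 \<le> l \<and> \<gamma> \<le> sample_sum X l \<omega>}. enat l))"

definition sample_total :: "(nat \<Rightarrow> 'a \<Rightarrow> nat) \<Rightarrow> nat \<Rightarrow> nat \<Rightarrow> 'a \<Rightarrow> nat" where
  "sample_total X \<gamma> n \<omega> = sample_sum X (sample_size X \<gamma> n \<omega>) \<omega>"

definition rate_estimate :: "(nat \<Rightarrow> 'a \<Rightarrow> nat) \<Rightarrow> nat \<Rightarrow> nat \<Rightarrow> 'a \<Rightarrow> real" where
  "rate_estimate X \<gamma> n \<omega> =
     real (min (sample_total X \<gamma> n \<omega>) \<gamma>) / real (sample_size X \<gamma> n \<omega>)"

end

theory Submission
  imports Defs
begin

text \<open>
  Comparing \<open>lam\<close> with a confidence limit amounts to comparing a Poisson tail at parameter \<open>lam\<close> with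
  \<open>\<delta> / 2\<close>, because Poisson tails are strictly monotone in the mean. The sample sizes and totals for
  which a limit fails are therefore determined by thresholds. Since the sampling stops by stage \<open>m\<close> at
  the threshold exactly if the sum of the first \<open>m\<close> samples reaches \<open>\<gamma>\<close>, each failure event is contained
  in an event \<open>S\<^sub>m \<ge> a\<close> or \<open>S\<^sub>m < a\<close> for one deterministic pair \<open>(m, a)\<close>, where \<open>S\<^sub>m\<close> is
  Poisson with mean \<open>m * lam\<close>; extremality of the pair makes the probability at most \<open>\<delta> / 2\<close>.
\<close>

section \<open>Poisson tails\<close>

text \<open>The probability that a Poisson variable of mean \<open>x\<close> is less than
  \<open>m\<close>. With a strict bound, its complement is the tail starting at
  \<open>m\<close>.\<close>

definition poisson_below :: "nat \<Rightarrow> real \<Rightarrow> real" where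
  "poisson_below m x = (\<Sum>i<m. x ^ i / fact i * exp (- x))"

lemma poisson_below_0 [simp]: "poisson_below 0 x = 0"
  by (simp add: poisson_below_def)

lemma poisson_below_at_0 [simp]:
  assumes "m > 0"
  shows "poisson_below m 0 = 1"
proof -
  have "(\<Sum>i<m. (0::real) ^ i / fact i) = (\<Sum>i\<in>{0}. 0 ^ i / fact i)"
    using assms by (intro sum.mono_neutral_right) auto
  then show ?thesis by (simp add: poisson_below_def)
qed

lemma poisson_below_mono:
  assumes "0 \<le> x" "l \<le> m"
  shows "poisson_below l x \<le> poisson_below m x"
  unfolding poisson_below_def using assms by (intro sum_mono2) auto

text \<open>The derivatives of the summands telescope: the positive part of each new one cancels
  what the previous sum left over.\<close>

lemma DERIV_poisson_below_Suc:
  "(poisson_below (Suc k) has_real_derivative - (x ^ k / fact k * exp (- x))) (at x)"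
proof (induction k)
  case 0
  show ?case unfolding poisson_below_def by (auto intro!: derivative_eq_intros)
next
  case (Suc k)
  have eq: "poisson_below (Suc (Suc k)) =
      (\<lambda>x. poisson_below (Suc k) x + x ^ Suc k / fact (Suc k) * exp (- x))"
    by (rule ext) (simp add: poisson_below_def)
  have pow: "((\<lambda>x. x ^ Suc k / fact (Suc k)) has_real_derivative x ^ k / fact k) (at x)"
    by (rule DERIV_cong[OF DERIV_cdivide[OF DERIV_pow]]) (simp add: fact_Suc del: of_nat_Suc)
  have ex: "((\<lambda>x. exp (- x)) has_real_derivative - exp (- x)) (at x)"
    by (auto intro!: derivative_eq_intros)
  show ?case unfolding eq
    using DERIV_add[OF Suc.IH DERIV_mult[OF pow ex]] by (simp add: algebra_simps)
qed

lemma poisson_below_strict_antimono: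
  assumes "m > 0" "0 \<le> x" "x < y"
  shows "poisson_below m y < poisson_below m x"
proof -
  obtain k where m: "m = Suc k" using assms(1) gr0_implies_Suc by blast
  have "continuous_on {x..y} (poisson_below m)"
    unfolding m using DERIV_poisson_below_Suc
    by (rule DERIV_continuous_on[OF has_field_derivative_at_within])
  \<comment> \<open>Only interior points are used: at 0 the derivative vanishes when
    \<open>k > 0\<close>, whereas \<open>z > x \<ge> 0\<close> makes it strictly negative.\<close>
  moreover have "\<exists>d. (poisson_below m has_real_derivative d) (at z) \<and> d < 0" if "x < z" "z < y" for z
    using DERIV_poisson_below_Suc[of k z] that assms unfolding m
    by (intro exI[of _ "- (z ^ k / fact k * exp (- z))"]) simp
  ultimately show ?thesis
    using DERIV_neg_imp_decreasing_open[OF assms(3)] by blast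
qed

lemma poisson_below_le_iff:
  assumes "m > 0" "0 \<le> x" "0 \<le> y"
  shows "poisson_below m y \<le> poisson_below m x \<longleftrightarrow> x \<le> y"
  using poisson_below_strict_antimono[OF assms(1,2), of y]
    poisson_below_strict_antimono[OF assms(1,3), of x]
  by (cases x y rule: linorder_cases) (simp_all only: less_imp_le not_le[symmetric] order_refl simp_thms)

text \<open>The exponential series gives total mass 1, from which the first \<open>m\<close> terms
  are removed. This brings the equations for \<open>L\<close> into the form of
  \<open>poisson_below\<close>.\<close>

lemma infsum_poisson_tail:
  assumes "0 \<le> x"
  shows "(\<Sum>\<^sub>\<infinity>i\<in>{m..}. 1 / fact i * x ^ i * exp (- x)) = 1 - poisson_below m x"
proof -
  define p where "p i = 1 / fact i * x ^ i * exp (- x)" for i :: nat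
  have "(\<lambda>i. (x ^ i /\<^sub>R fact i) * exp (- x)) sums (exp x * exp (- x))"
    by (intro sums_mult2 exp_converges)
  then have "p sums 1"
    by (simp add: p_def[abs_def] exp_minus field_simps)
  then have "(p has_sum 1) UNIV"
    using assms by (intro sums_nonneg_imp_has_sum) (auto simp: p_def)
  then have "(p has_sum (1 - sum p {..<m})) (UNIV - {..<m})"
    by (intro has_sum_Diff) auto
  moreover have "UNIV - {..<m} = {m..}" by auto
  moreover have "sum p {..<m} = poisson_below m x"
    by (simp add: p_def poisson_below_def)
  ultimately show ?thesis
    unfolding p_def by (simp add: infsumI)
qed

lemma sum_poisson_eq_poisson_below:
  assumes "m > 0"
  shows "(\<Sum>i=0..m - 1. 1 / fact i * x ^ i * exp (- x)) = poisson_below m x"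
proof -
  have "{0..m - 1} = {..<m}" using assms by auto
  then show ?thesis by (simp add: poisson_below_def)
qed

text \<open>The binomial theorem divided by \<open>fact k\<close>; it drives the induction for the
  distribution of the sample sums.\<close>

lemma poisson_convolution:
  fixes a b :: real
  shows "(\<Sum>j\<le>k. (a ^ j / fact j * exp (- a)) * (b ^ (k - j) / fact (k - j) * exp (- b))) =
    (a + b) ^ k / fact k * exp (- (a + b))"
proof -
  have "(a + b) ^ k / fact k = (\<Sum>j\<le>k. (a ^ j / fact j) * (b ^ (k - j) / fact (k - j)))"
    unfolding binomial_ring sum_divide_distrib
    by (intro sum.cong) (auto simp: binomial_fact field_simps)
  moreover have "exp (- (a + b)) = exp (- a) * exp (- b)"
    by (simp flip: exp_add)
  ultimately show ?thesis
    by (simp add: sum_distrib_left mult_ac)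
qed

section \<open>The stopping rule\<close>

lemma sample_sum_mono: "l \<le> m \<Longrightarrow> sample_sum X l \<omega> \<le> sample_sum X m \<omega>"
  unfolding sample_sum_def by (intro sum_mono2) auto

lemma sample_sum_0 [simp]: "sample_sum X 0 \<omega> = 0"
  by (simp add: sample_sum_def)

text \<open>A minimum is determined by its lower bounds. Later proofs use this form instead of the
  definition with its infimum in \<open>enat\<close>.\<close>

lemma le_sample_size_iff:
  "k \<le> sample_size X \<gamma> n \<omega> \<longleftrightarrow> k \<le> n \<and> (\<forall>l\<ge>1. \<gamma> \<le> sample_sum X l \<omega> \<longrightarrow> k \<le> l)"
proof -
  define I where "I = (INF l \<in> {l. 1 \<le> l \<and> \<gamma> \<le> sample_sum X l \<omega>}. enat l)"
  \<comment> \<open>The cap \<open>n\<close> keeps the minimum finite, so \<open>the_enat\<close>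
    loses nothing.\<close>
  have "min (enat n) I \<noteq> \<infinity>" by (cases I) auto
  then have "enat (sample_size X \<gamma> n \<omega>) = min (enat n) I"
    unfolding sample_size_def I_def[symmetric] by (cases "min (enat n) I") auto
  then have "k \<le> sample_size X \<gamma> n \<omega> \<longleftrightarrow> enat k \<le> min (enat n) I"
    by (metis enat_ord_simps(1))
  also have "\<dots> \<longleftrightarrow> k \<le> n \<and> (\<forall>l\<ge>1. \<gamma> \<le> sample_sum X l \<omega> \<longrightarrow> k \<le> l)"
    by (auto simp: I_def le_INF_iff)
  finally show ?thesis .
qed

lemma sample_size_le: "sample_size X \<gamma> n \<omega> \<le> n"
  by (rule conjunct1[OF iffD1[OF le_sample_size_iff order_refl]])

lemma sample_size_pos: "n > 0 \<Longrightarrow> sample_size X \<gamma> n \<omega> > 0"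
  using le_sample_size_iff[of 1 X \<gamma> n \<omega>] by linarith

lemma sample_sum_less_threshold:
  assumes "l < sample_size X \<gamma> n \<omega>" "\<gamma> > 0"
  shows "sample_sum X l \<omega> < \<gamma>"
\<comment> \<open>Stage 0 is not a candidate for stopping; there the empty sum lies below \<gamma>
  because \<open>\<gamma> > 0\<close>.\<close>
proof (cases "l = 0")
  case False
  have "\<not> \<gamma> \<le> sample_sum X l \<omega>"
  proof
    assume "\<gamma> \<le> sample_sum X l \<omega>"
    moreover have "Suc l \<le> sample_size X \<gamma> n \<omega>" "1 \<le> l" using assms(1) False by auto
    ultimately have "Suc l \<le> l" unfolding le_sample_size_iff by blast
    then show False by simp
  qed
  then show ?thesis by simp
qed (use assms in simp)

text \<open>Stopping before \<open>n\<close> occurs only at the threshold, and sums are monotone. A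
  condition at the random stopping stage thus becomes one at the fixed stage
  \<open>n\<close>.\<close>

lemma threshold_reached_iff:
  "\<gamma> \<le> sample_total X \<gamma> n \<omega> \<longleftrightarrow> \<gamma> \<le> sample_sum X n \<omega>"
proof
  assume "\<gamma> \<le> sample_sum X n \<omega>"
  show "\<gamma> \<le> sample_total X \<gamma> n \<omega>"
  proof (cases "sample_size X \<gamma> n \<omega> = n")
    case False
    then have "Suc (sample_size X \<gamma> n \<omega>) \<le> n" using sample_size_le[of X \<gamma> n \<omega>] by simp
    moreover have "\<not> Suc (sample_size X \<gamma> n \<omega>) \<le> sample_size X \<gamma> n \<omega>" by simp
    ultimately obtain l where l: "\<gamma> \<le> sample_sum X l \<omega>" "\<not> Suc (sample_size X \<gamma> n \<omega>) \<le> l"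
      unfolding le_sample_size_iff[of "Suc (sample_size X \<gamma> n \<omega>)" X \<gamma> n \<omega>] by blast
    then show ?thesis
      using sample_sum_mono[of l "sample_size X \<gamma> n \<omega>" X \<omega>] by (simp add: sample_total_def)
  qed (use \<open>\<gamma> \<le> sample_sum X n \<omega>\<close> in \<open>simp add: sample_total_def\<close>)
qed (unfold sample_total_def, erule le_trans, rule sample_sum_mono[OF sample_size_le])

lemma sample_size_eq_max:
  assumes "sample_sum X n \<omega> < \<gamma>"
  shows "sample_size X \<gamma> n \<omega> = n"
proof -
  have "n \<le> l" if "\<gamma> \<le> sample_sum X l \<omega>" for l
    using that assms sample_sum_mono[of l n X \<omega>] by linarith
  then have "n \<le> sample_size X \<gamma> n \<omega>"
    using le_sample_size_iff[of n X \<gamma> n \<omega>] by blast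
  then show ?thesis
    using sample_size_le[of X \<gamma> n \<omega>] by (rule antisym[rotated])
qed

lemma rate_estimate_below:
  assumes "sample_sum X n \<omega> < \<gamma>"
  shows "rate_estimate X \<gamma> n \<omega> = real (sample_sum X n \<omega>) / real n"
  using assms unfolding rate_estimate_def sample_total_def sample_size_eq_max[OF assms] by simp

text \<open>If the threshold is reached, truncation makes the numerator exactly \<gamma> and the
  denominator is at most \<open>n\<close>; otherwise the estimate is the sample mean over
  \<open>n\<close>. This turns the case conditions on the estimate into conditions on the sum at
  stage \<open>n\<close>.\<close>

lemma rate_estimate_ge_iff:
  assumes "n > 0" "\<gamma> > 0"
  shows "real \<gamma> / real n \<le> rate_estimate X \<gamma> n \<omega> \<longleftrightarrow> \<gamma> \<le> sample_sum X n \<omega>"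
proof (cases "\<gamma> \<le> sample_sum X n \<omega>")
  case True
  then have "\<gamma> \<le> sample_total X \<gamma> n \<omega>" by (simp only: threshold_reached_iff)
  then have "rate_estimate X \<gamma> n \<omega> = real \<gamma> / real (sample_size X \<gamma> n \<omega>)"
    unfolding rate_estimate_def by (simp only: min_absorb2)
  moreover have "real \<gamma> / real n \<le> real \<gamma> / real (sample_size X \<gamma> n \<omega>)"
    using sample_size_pos[OF assms(1), of X \<gamma> \<omega>] sample_size_le[of X \<gamma> n \<omega>]
    by (intro divide_left_mono) auto
  ultimately show ?thesis using True by simp
next
  case False
  then show ?thesis
    using assms by (simp add: rate_estimate_below divide_le_cancel)
qed

lemma rate_estimate_eq_0_iff:
  assumes "n > 0" "\<gamma> > 0"
  shows "rate_estimate X \<gamma> n \<omega> = 0 \<longleftrightarrow> sample_sum X n \<omega> = 0"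
proof (cases "\<gamma> \<le> sample_sum X n \<omega>")
  case True
  moreover have "0 < real \<gamma> / real n" using assms by simp
  ultimately have "0 < rate_estimate X \<gamma> n \<omega>"
    using rate_estimate_ge_iff[OF assms, of X \<omega>] by linarith
  then show ?thesis using True assms by linarith
next
  case False
  then show ?thesis using assms by (simp add: rate_estimate_below)
qed

lemma rate_estimate_less_threshold:
  assumes "n > 0" "\<gamma> > 0" "sample_size X \<gamma> n \<omega> \<noteq> 1"
  shows "rate_estimate X \<gamma> n \<omega> < real \<gamma>"
proof -
  have "1 < real (sample_size X \<gamma> n \<omega>)"
    using sample_size_pos[OF assms(1), of X \<gamma> \<omega>] assms(3) by simp
  then have "real \<gamma> / real (sample_size X \<gamma> n \<omega>) < real \<gamma> / 1"
    using assms(2) by (intro divide_strict_left_mono) auto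
  moreover have "rate_estimate X \<gamma> n \<omega> \<le> real \<gamma> / real (sample_size X \<gamma> n \<omega>)"
    unfolding rate_estimate_def by (intro divide_right_mono) auto
  ultimately show ?thesis by linarith
qed

section \<open>Poisson samples\<close>

lemma measurable_sum_nat:
  fixes f :: "'i \<Rightarrow> 'a \<Rightarrow> nat"
  assumes "finite I" "\<And>i. i \<in> I \<Longrightarrow> f i \<in> measurable M (count_space UNIV)"
  shows "(\<lambda>x. \<Sum>i\<in>I. f i x) \<in> measurable M (count_space UNIV)"
  using assms
proof (induction I rule: finite_induct)
  case (insert i I)
  have "(\<lambda>x. f i x + (\<Sum>i\<in>I. f i x)) \<in> measurable M (count_space UNIV)"
    by (rule measurable_compose_countable[where f = "\<lambda>k x. k + (\<Sum>i\<in>I. f i x)"])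
      (use insert in \<open>auto intro: measurable_compose\<close>)
  then show ?case using insert.hyps by simp
qed simp

locale poisson_samples = prob_space M for M :: "'a measure" +
  fixes X :: "nat \<Rightarrow> 'a \<Rightarrow> nat" and lam :: real
  assumes lam_pos: "lam > 0"
    and indep: "indep_vars (\<lambda>_. count_space UNIV) X {1..}"
    and distr_X: "i \<ge> 1 \<Longrightarrow> distr M (count_space UNIV) (X i) = measure_pmf (poisson_pmf lam)"
begin

lemma measurable_X: "i \<ge> 1 \<Longrightarrow> X i \<in> measurable M (count_space UNIV)"
  using indep by (auto simp: indep_vars_def)

lemma measurable_sample_sum [measurable]: "sample_sum X l \<in> measurable M (count_space UNIV)"
  unfolding sample_sum_def[abs_def] by (intro measurable_sum_nat measurable_X) auto

lemma measurable_sample_size [measurable]: "sample_size X \<gamma> n \<in> measurable M (count_space UNIV)"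
proof -
  \<comment> \<open>In this form \<open>le_sample_size_iff\<close> reduces measurability to
    countably many conditions on sample sums.\<close>
  have "sample_size X \<gamma> n = (\<lambda>\<omega>. LEAST m. \<not> Suc m \<le> sample_size X \<gamma> n \<omega>)"
    by (auto intro!: ext Least_equality[symmetric])
  also have "\<dots> \<in> measurable M (count_space UNIV)"
    unfolding le_sample_size_iff by measurable
  finally show ?thesis .
qed

lemma prob_X_eq:
  assumes "i \<ge> 1"
  shows "prob (X i -` {k} \<inter> space M) = lam ^ k / fact k * exp (- lam)"
proof -
  have "prob (X i -` {k} \<inter> space M) = measure (distr M (count_space UNIV) (X i)) {k}"
    using measurable_X[OF assms] by (subst measure_distr) auto
  then show ?thesis
    using lam_pos by (simp add: distr_X[OF assms] measure_pmf_single)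
qed

text \<open>The two variables are functions of the samples over the disjoint index blocks
  \<open>{1..l}\<close> and \<open>{Suc l}\<close>.\<close>

lemma indep_sample_sum_X:
  "indep_var (count_space UNIV) (sample_sum X l) (count_space UNIV) (X (Suc l))"
proof -
  have "indep_var
      (count_space UNIV) ((\<lambda>f. \<Sum>i=1..l. f i) \<circ> (\<lambda>\<omega>. restrict (\<lambda>i. X i \<omega>) {1..l}))
      (count_space UNIV) ((\<lambda>f. f (Suc l)) \<circ> (\<lambda>\<omega>. restrict (\<lambda>i. X i \<omega>) {Suc l}))"
    by (intro indep_var_compose[OF indep_var_restrict[OF indep]] measurable_sum_nat) auto
  moreover have "(\<lambda>f. \<Sum>i=1..l. f i) \<circ> (\<lambda>\<omega>. restrict (\<lambda>i. X i \<omega>) {1..l}) = sample_sum X l"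
    by (auto simp: sample_sum_def)
  moreover have "(\<lambda>f. f (Suc l)) \<circ> (\<lambda>\<omega>. restrict (\<lambda>i. X i \<omega>) {Suc l}) = X (Suc l)"
    by auto
  ultimately show ?thesis by simp
qed

lemma prob_sample_sum_eq:
  "prob (sample_sum X l -` {k} \<inter> space M) = (real l * lam) ^ k / fact k * exp (- (real l * lam))"
proof (induction l arbitrary: k)
  case 0
  have "sample_sum X 0 -` {k} \<inter> space M = (if k = 0 then space M else {})"
    by (auto simp: sample_sum_def)
  then show ?case by (simp add: prob_space)
next
  case (Suc l)
  \<comment> \<open>The event is split by the value \<open>j\<close> of the first \<open>l\<close>
    samples. The product form matches \<open>indep_varD\<close>, and \<open>k - j\<close> is exact
    since only \<open>j \<le> k\<close> occurs.\<close>
  define A where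
    "A j = (\<lambda>\<omega>. (sample_sum X l \<omega>, X (Suc l) \<omega>)) -` ({j} \<times> {k - j}) \<inter> space M" for j
  note [measurable] = measurable_X[of "Suc l", simplified]
  have A: "A j \<in> events" for j
  proof -
    have "A j = {\<omega> \<in> space M. sample_sum X l \<omega> = j \<and> X (Suc l) \<omega> = k - j}"
      by (auto simp: A_def)
    then show ?thesis by simp
  qed
  have "sample_sum X (Suc l) -` {k} \<inter> space M = (\<Union>j\<le>k. A j)"
    by (auto simp: A_def sample_sum_def)
  then have "prob (sample_sum X (Suc l) -` {k} \<inter> space M) = (\<Sum>j\<le>k. prob (A j))"
    using A by (simp only:) (intro finite_measure_finite_Union, auto simp: disjoint_family_on_def A_def)
  also have "\<dots> = (\<Sum>j\<le>k. ((real l * lam) ^ j / fact j * exp (- (real l * lam))) *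
      (lam ^ (k - j) / fact (k - j) * exp (- lam)))"
  proof (intro sum.cong refl)
    fix j
    have "prob (A j) =
        prob (sample_sum X l -` {j} \<inter> space M) * prob (X (Suc l) -` {k - j} \<inter> space M)"
      unfolding A_def by (rule indep_varD[OF indep_sample_sum_X]) auto
    then show "prob (A j) = (real l * lam) ^ j / fact j * exp (- (real l * lam)) *
        (lam ^ (k - j) / fact (k - j) * exp (- lam))"
      using prob_X_eq[of "Suc l" "k - j"] by (simp add: Suc.IH)
  qed
  finally show ?case
    unfolding poisson_convolution by (simp add: algebra_simps)
qed

lemma prob_sample_sum_less:
  "prob {\<omega> \<in> space M. sample_sum X l \<omega> < m} = poisson_below m (real l * lam)"
proof -
  have "{\<omega> \<in> space M. sample_sum X l \<omega> < m} = (\<Union>k<m. sample_sum X l -` {k} \<inter> space M)"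
    by auto
  then have "prob {\<omega> \<in> space M. sample_sum X l \<omega> < m} =
      (\<Sum>k<m. prob (sample_sum X l -` {k} \<inter> space M))"
    by (simp only:) (intro finite_measure_finite_Union,
        auto simp: disjoint_family_on_def intro: measurable_sets[OF measurable_sample_sum])
  then show ?thesis
    by (simp add: prob_sample_sum_eq poisson_below_def)
qed

lemma prob_sample_sum_ge:
  "prob {\<omega> \<in> space M. m \<le> sample_sum X l \<omega>} = 1 - poisson_below m (real l * lam)"
proof -
  have "{\<omega> \<in> space M. m \<le> sample_sum X l \<omega>} = space M - {\<omega> \<in> space M. sample_sum X l \<omega> < m}"
    by auto
  then show ?thesis by (simp add: prob_compl prob_sample_sum_less)
qed

section \<open>Failure of the confidence limits\<close>

text \<open>Stated through tails instead of \<open>L\<close>, so that measurability comes from the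
  samples. At sum 0 the tail is 1, so for \<open>\<epsilon> < 1\<close> there is no failure, in
  accordance with \<open>L = 0\<close>.\<close>

definition lower_fails :: "nat \<Rightarrow> nat \<Rightarrow> real \<Rightarrow> 'a \<Rightarrow> bool" where
  "lower_fails \<gamma> n \<epsilon> \<omega> \<longleftrightarrow>
    (if \<gamma> \<le> sample_sum X n \<omega>
     then 1 - poisson_below \<gamma> (real (sample_size X \<gamma> n \<omega>) * lam) \<le> \<epsilon>
     else 1 - poisson_below (sample_sum X n \<omega>) (real n * lam) \<le> \<epsilon>)"

text \<open>The case of a single sample is excluded because the limit is then infinite. One is
  subtracted since the stage before stopping is still below \<gamma>; \<open>Suc\<close> includes
  the observed total in the lower tail.\<close>

definition upper_fails :: "nat \<Rightarrow> nat \<Rightarrow> real \<Rightarrow> 'a \<Rightarrow> bool" where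
  "upper_fails \<gamma> n \<epsilon> \<omega> \<longleftrightarrow> sample_size X \<gamma> n \<omega> \<noteq> 1 \<and>
    (if \<gamma> \<le> sample_sum X n \<omega>
     then poisson_below \<gamma> (real (sample_size X \<gamma> n \<omega> - 1) * lam) \<le> \<epsilon>
     else poisson_below (Suc (sample_sum X n \<omega>)) (real n * lam) \<le> \<epsilon>)"

lemma lower_fails_event [measurable]: "{\<omega> \<in> space M. lower_fails \<gamma> n \<epsilon> \<omega>} \<in> events"
  unfolding lower_fails_def by measurable

lemma upper_fails_event [measurable]: "{\<omega> \<in> space M. upper_fails \<gamma> n \<epsilon> \<omega>} \<in> events"
  unfolding upper_fails_def by measurable

text \<open>The split asks whether the corner pair \<open>(n, \<gamma>)\<close> already has upper
  tail at most \<epsilon>. If so, \<open>n\<close> is kept and the count lowered to the least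
  admissible \<open>a\<close>; if not, \<gamma> is kept and the stage lowered to the greatest
  admissible \<open>m\<close>.\<close>

lemma prob_lower_fails:
  assumes "\<gamma> > 0" "0 \<le> \<epsilon>"
  shows "prob {\<omega> \<in> space M. lower_fails \<gamma> n \<epsilon> \<omega>} \<le> \<epsilon>"
proof (cases "1 - poisson_below \<gamma> (real n * lam) \<le> \<epsilon>")
  case True
  define P where "P k \<longleftrightarrow> 1 - poisson_below k (real n * lam) \<le> \<epsilon>" for k
  define a where "a = (LEAST k. P k)"
  have a: "P a" "a \<le> \<gamma>"
    using True by (auto simp: a_def P_def intro: LeastI Least_le)
  \<comment> \<open>If the threshold is reached, \<open>a \<le> \<gamma>\<close> suffices; otherwise
    the sum itself satisfies \<open>P\<close> and \<open>a\<close> is least.\<close>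
  have "a \<le> sample_sum X n \<omega>" if "lower_fails \<gamma> n \<epsilon> \<omega>" for \<omega>
    using that a by (auto simp: lower_fails_def P_def a_def intro: Least_le split: if_splits)
  then have "prob {\<omega> \<in> space M. lower_fails \<gamma> n \<epsilon> \<omega>} \<le> prob {\<omega> \<in> space M. a \<le> sample_sum X n \<omega>}"
    by (intro finite_measure_mono) auto
  then show ?thesis using a by (simp add: prob_sample_sum_ge P_def)
next
  case False
  define P where "P m \<longleftrightarrow> m \<le> n \<and> 1 - poisson_below \<gamma> (real m * lam) \<le> \<epsilon>" for m
  define m where "m = (GREATEST k. P k)"
  \<comment> \<open>At mean 0 the tail from \<open>\<gamma> > 0\<close> vanishes, so a greatest
    \<open>m\<close> exists below the cap \<open>n\<close>.\<close>
  have "P 0" using assms by (simp add: P_def)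
  then have m: "P m"
    unfolding m_def by (rule GreatestI_nat[where b = n]) (simp add: P_def)
  have "\<gamma> \<le> sample_sum X m \<omega>" if fails: "lower_fails \<gamma> n \<epsilon> \<omega>" for \<omega>
  proof -
    \<comment> \<open>A count below \<gamma> has an upper tail at least that of the corner, which
      exceeds \<epsilon>.\<close>
    have reached: "\<gamma> \<le> sample_sum X n \<omega>"
    proof (rule ccontr)
      assume *: "\<not> \<gamma> \<le> sample_sum X n \<omega>"
      then have "poisson_below (sample_sum X n \<omega>) (real n * lam) \<le> poisson_below \<gamma> (real n * lam)"
        using lam_pos by (intro poisson_below_mono) auto
      with * False fails show False by (simp add: lower_fails_def)
    qed
    with fails have "P (sample_size X \<gamma> n \<omega>)"
      by (simp add: lower_fails_def P_def sample_size_le)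
    then have "sample_size X \<gamma> n \<omega> \<le> m"
      unfolding m_def by (rule Greatest_le_nat[where b = n]) (simp add: P_def)
    then show ?thesis
      using reached threshold_reached_iff[of \<gamma> X n \<omega>] unfolding sample_total_def
      by (meson sample_sum_mono le_trans)
  qed
  then have "prob {\<omega> \<in> space M. lower_fails \<gamma> n \<epsilon> \<omega>} \<le> prob {\<omega> \<in> space M. \<gamma> \<le> sample_sum X m \<omega>}"
    by (intro finite_measure_mono) auto
  then show ?thesis using m by (simp add: prob_sample_sum_ge P_def)
qed

text \<open>Dual to \<open>prob_lower_fails\<close>: either the least stage \<open>m\<close> whose
  lower tail below \<gamma> is at most \<epsilon>, or, if no stage up to \<open>n\<close> qualifies,
  the greatest count \<open>a\<close> at stage \<open>n\<close>.\<close>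

lemma prob_upper_fails:
  assumes "\<gamma> > 0" "n > 0" "0 \<le> \<epsilon>"
  shows "prob {\<omega> \<in> space M. upper_fails \<gamma> n \<epsilon> \<omega>} \<le> \<epsilon>"
proof (cases "\<exists>m\<le>n. poisson_below \<gamma> (real m * lam) \<le> \<epsilon>")
  case True
  define P where "P m \<longleftrightarrow> m \<le> n \<and> poisson_below \<gamma> (real m * lam) \<le> \<epsilon>" for m
  define m where "m = (LEAST k. P k)"
  have m: "P m"
    unfolding m_def using True by (rule LeastI_ex[OF ex_forward]) (simp add: P_def)
  have "sample_sum X m \<omega> < \<gamma>" if fails: "upper_fails \<gamma> n \<epsilon> \<omega>" for \<omega>
  proof (cases "\<gamma> \<le> sample_sum X n \<omega>")
    case True
    with fails have "P (sample_size X \<gamma> n \<omega> - 1)"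
      using sample_size_le[of X \<gamma> n \<omega>] by (auto simp: upper_fails_def P_def)
    then have "m \<le> sample_size X \<gamma> n \<omega> - 1" unfolding m_def by (rule Least_le)
    \<comment> \<open>The subtracted one pays off here: \<open>m\<close> lies strictly before
      stopping, where the sum is still below \<gamma>.\<close>
    then have "m < sample_size X \<gamma> n \<omega>"
      using sample_size_pos[OF assms(2), of X \<gamma> \<omega>] by linarith
    then show ?thesis using assms(1) by (rule sample_sum_less_threshold)
  next
    case False
    then show ?thesis
      using m sample_sum_mono[of m n X \<omega>] by (simp add: P_def)
  qed
  then have "prob {\<omega> \<in> space M. upper_fails \<gamma> n \<epsilon> \<omega>} \<le> prob {\<omega> \<in> space M. sample_sum X m \<omega> < \<gamma>}"
    by (intro finite_measure_mono) auto
  then show ?thesis using m by (simp add: prob_sample_sum_less P_def)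
next
  case False
  define P where "P k \<longleftrightarrow> poisson_below k (real n * lam) \<le> \<epsilon>" for k
  define a where "a = (GREATEST k. P k)"
  \<comment> \<open>Beyond \<gamma> the lower tail is at least that at \<gamma>, which exceeds
    \<epsilon>; hence a greatest \<open>a\<close> exists.\<close>
  have bound: "k \<le> \<gamma>" if "P k" for k
  proof (rule ccontr)
    assume "\<not> k \<le> \<gamma>"
    then have "poisson_below \<gamma> (real n * lam) \<le> poisson_below k (real n * lam)"
      using lam_pos by (intro poisson_below_mono) auto
    moreover have "\<epsilon> < poisson_below \<gamma> (real n * lam)"
      using False by (meson not_le order_refl)
    ultimately show False using that by (simp add: P_def)
  qed
  have "P 0" using assms by (simp add: P_def)
  then have a: "P a" unfolding a_def using bound by (rule GreatestI_nat)
  have "sample_sum X n \<omega> < a" if fails: "upper_fails \<gamma> n \<epsilon> \<omega>" for \<omega>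
  proof -
    have "\<not> poisson_below \<gamma> (real (sample_size X \<gamma> n \<omega> - 1) * lam) \<le> \<epsilon>"
      using False le_trans[OF diff_le_self sample_size_le[of X \<gamma> n \<omega>]] by blast
    with fails have "P (Suc (sample_sum X n \<omega>))"
      by (auto simp: upper_fails_def P_def split: if_splits)
    then have "Suc (sample_sum X n \<omega>) \<le> a"
      unfolding a_def using bound by (rule Greatest_le_nat)
    then show ?thesis by simp
  qed
  then have "prob {\<omega> \<in> space M. upper_fails \<gamma> n \<epsilon> \<omega>} \<le> prob {\<omega> \<in> space M. sample_sum X n \<omega> < a}"
    by (intro finite_measure_mono) auto
  then show ?thesis using a by (simp add: prob_sample_sum_less P_def)
qed

end

section \<open>Coverage probability of the confidence interval\<close>

theorem theorem12:
  fixes M :: "'a measure"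
    and X :: "nat \<Rightarrow> 'a \<Rightarrow> nat"
    and lam \<delta> :: real
    and \<gamma> n :: nat
    and L :: "'a \<Rightarrow> real"
    and U :: "'a \<Rightarrow> ereal"
  assumes "prob_space M"
    and "lam > 0"
    and "prob_space.indep_vars M (\<lambda>_. count_space UNIV) X {1..}"
    and "\<And>i. i \<ge> 1 \<Longrightarrow> distr M (count_space UNIV) (X i) = measure_pmf (poisson_pmf lam)"
    and "\<gamma> > 0" and "n > 0"
    and "0 < \<delta>" and "\<delta> < 1"
    and "\<And>\<omega>. \<omega> \<in> space M \<Longrightarrow> L \<omega> \<ge> 0"
    and "\<And>\<omega>. \<omega> \<in> space M \<Longrightarrow> rate_estimate X \<gamma> n \<omega> = 0 \<Longrightarrow> L \<omega> = 0"
    and "\<And>\<omega>. \<omega> \<in> space M \<Longrightarrow> rate_estimate X \<gamma> n \<omega> \<ge> real \<gamma> / real n \<Longrightarrow>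
           (\<Sum>\<^sub>\<infinity>i\<in>{\<gamma>..}. 1 / fact i * (real (sample_size X \<gamma> n \<omega>) * L \<omega>) ^ i
              * exp (- (real (sample_size X \<gamma> n \<omega>) * L \<omega>))) = \<delta> / 2"
    and "\<And>\<omega>. \<omega> \<in> space M \<Longrightarrow> 0 < rate_estimate X \<gamma> n \<omega> \<Longrightarrow>
           rate_estimate X \<gamma> n \<omega> < real \<gamma> / real n \<Longrightarrow>
           (\<Sum>\<^sub>\<infinity>i\<in>{sample_total X \<gamma> n \<omega>..}. 1 / fact i * (real n * L \<omega>) ^ i
              * exp (- (real n * L \<omega>))) = \<delta> / 2"
    and "\<And>\<omega>. \<omega> \<in> space M \<Longrightarrow> U \<omega> \<ge> 0"
    and "\<And>\<omega>. \<omega> \<in> space M \<Longrightarrow> sample_size X \<gamma> n \<omega> = 1 \<Longrightarrow> U \<omega> = \<infinity>"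
    and "\<And>\<omega>. \<omega> \<in> space M \<Longrightarrow> sample_size X \<gamma> n \<omega> \<noteq> 1 \<Longrightarrow>
           real \<gamma> / real n \<le> rate_estimate X \<gamma> n \<omega> \<Longrightarrow> rate_estimate X \<gamma> n \<omega> < real \<gamma> \<Longrightarrow>
           U \<omega> \<noteq> \<infinity> \<and>
           (\<Sum>i=0..\<gamma>-1. 1 / fact i * ((real (sample_size X \<gamma> n \<omega>) - 1) * real_of_ereal (U \<omega>)) ^ i
              * exp (- ((real (sample_size X \<gamma> n \<omega>) - 1) * real_of_ereal (U \<omega>)))) = \<delta> / 2"
    and "\<And>\<omega>. \<omega> \<in> space M \<Longrightarrow> sample_size X \<gamma> n \<omega> \<noteq> 1 \<Longrightarrow>
           rate_estimate X \<gamma> n \<omega> < real \<gamma> / real n \<Longrightarrow>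
           U \<omega> \<noteq> \<infinity> \<and>
           (\<Sum>i=0..sample_total X \<gamma> n \<omega>. 1 / fact i * (real n * real_of_ereal (U \<omega>)) ^ i
              * exp (- (real n * real_of_ereal (U \<omega>)))) = \<delta> / 2"
  shows "prob_space.prob M {\<omega> \<in> space M. L \<omega> < lam \<and> ereal lam < U \<omega>} \<ge> 1 - \<delta>"
proof -
  interpret poisson_samples M X lam
    using assms(1-4) by (intro poisson_samples.intro poisson_samples_axioms.intro)
  note \<gamma> = \<open>\<gamma> > 0\<close> and n = \<open>n > 0\<close>
  note ge_iff = rate_estimate_ge_iff[OF n \<gamma>, of X]
  note zero_iff = rate_estimate_eq_0_iff[OF n \<gamma>, of X]
  \<comment> \<open>An equivalence, not just an implication, so that the coverage event is exactly
    the complement of two measurable events.\<close>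
  have lower: "lam \<le> L \<omega> \<longleftrightarrow> lower_fails \<gamma> n (\<delta> / 2) \<omega>" if \<omega>: "\<omega> \<in> space M" for \<omega>
  proof -
    note L0 = assms(9)[OF \<omega>]
    have scale: "1 - poisson_below m (real j * lam) \<le> \<delta> / 2 \<longleftrightarrow> lam \<le> L \<omega>"
      if "m > 0" "j > 0" and
        "(\<Sum>\<^sub>\<infinity>i\<in>{m..}. 1 / fact i * (real j * L \<omega>) ^ i * exp (- (real j * L \<omega>))) = \<delta> / 2" for m j
    proof -
      have "\<delta> / 2 = 1 - poisson_below m (real j * L \<omega>)"
        using that(3) infsum_poisson_tail[of "real j * L \<omega>" m] L0 by simp
      then show ?thesis
        using poisson_below_le_iff[of m "real j * lam" "real j * L \<omega>"] that(1,2) L0 lam_pos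
        by simp
    qed
    consider (reached) "\<gamma> \<le> sample_sum X n \<omega>" | (zero) "sample_sum X n \<omega> = 0"
      | (below) "0 < sample_sum X n \<omega>" "sample_sum X n \<omega> < \<gamma>" by linarith
    then show ?thesis
    proof cases
      case reached
      then show ?thesis
        using scale[OF \<gamma> sample_size_pos[OF n, of X \<gamma> \<omega>]] assms(11)[OF \<omega>]
        by (simp add: ge_iff lower_fails_def)
    next
      \<comment> \<open>Both sides are false: \<open>L \<omega> = 0 < lam\<close>, while the tail
        from 0 is \<open>1 > \<delta> / 2\<close>.\<close>
      case zero
      then show ?thesis
        using assms(10)[OF \<omega>] zero_iff lam_pos \<open>\<delta> < 1\<close> \<gamma> by (simp add: lower_fails_def)
    next
      case below
      have "sample_total X \<gamma> n \<omega> = sample_sum X n \<omega>"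
        using below(2) by (simp add: sample_total_def sample_size_eq_max)
      moreover have "rate_estimate X \<gamma> n \<omega> < real \<gamma> / real n"
        using below(2) ge_iff[of \<omega>] by linarith
      moreover have "0 < rate_estimate X \<gamma> n \<omega>"
      proof -
        have "0 \<le> rate_estimate X \<gamma> n \<omega>" by (simp add: rate_estimate_def)
        then show ?thesis using below(1) zero_iff[of \<omega>] by linarith
      qed
      ultimately show ?thesis
        using scale[OF below(1) n] assms(12)[OF \<omega>] below by (simp add: lower_fails_def)
    qed
  qed
  have upper: "U \<omega> \<le> ereal lam \<longleftrightarrow> upper_fails \<gamma> n (\<delta> / 2) \<omega>" if \<omega>: "\<omega> \<in> space M" for \<omega>
  proof (cases "sample_size X \<gamma> n \<omega> = 1")
    case True
    then show ?thesis using assms(14)[OF \<omega>] by (simp add: upper_fails_def)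
  next
    case False
    note N = sample_size_pos[OF n, of X \<gamma> \<omega>]
    have scale: "poisson_below m (real j * lam) \<le> \<delta> / 2 \<longleftrightarrow> U \<omega> \<le> ereal lam"
      if pos: "m > 0" "j > 0" and fin: "U \<omega> \<noteq> \<infinity>" and
        eq: "poisson_below m (real j * real_of_ereal (U \<omega>)) = \<delta> / 2" for m j
    proof -
      \<comment> \<open>Finiteness matters because \<open>real_of_ereal\<close> sends infinity to 0;
        nonnegativity rules out minus infinity.\<close>
      obtain u where u: "U \<omega> = ereal u" "u \<ge> 0"
        using fin assms(13)[OF \<omega>] by (cases "U \<omega>") auto
      then show ?thesis
        using poisson_below_le_iff[of m "real j * u" "real j * lam"] pos lam_pos
        unfolding eq[symmetric] by simp
    qed
    show ?thesis
    proof (cases "\<gamma> \<le> sample_sum X n \<omega>")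
      case True
      have N': "real (sample_size X \<gamma> n \<omega> - 1) = real (sample_size X \<gamma> n \<omega>) - 1"
        using N by (simp add: of_nat_diff)
      have "U \<omega> \<noteq> \<infinity> \<and>
          poisson_below \<gamma> (real (sample_size X \<gamma> n \<omega> - 1) * real_of_ereal (U \<omega>)) = \<delta> / 2"
        using assms(15)[OF \<omega> False iffD2[OF ge_iff True] rate_estimate_less_threshold[OF n \<gamma> False]]
        unfolding N' sum_poisson_eq_poisson_below[OF \<gamma>] .
      then show ?thesis
        using scale[OF \<gamma>, of "sample_size X \<gamma> n \<omega> - 1"] True False N by (simp add: upper_fails_def)
    next
      case below: False
      then have "sample_total X \<gamma> n \<omega> = sample_sum X n \<omega>"
        by (simp add: sample_total_def sample_size_eq_max)
      moreover have "rate_estimate X \<gamma> n \<omega> < real \<gamma> / real n"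
        using below ge_iff[of \<omega>] by linarith
      ultimately have "U \<omega> \<noteq> \<infinity> \<and>
          poisson_below (Suc (sample_sum X n \<omega>)) (real n * real_of_ereal (U \<omega>)) = \<delta> / 2"
        using assms(16)[OF \<omega> False] 
          sum_poisson_eq_poisson_below[of "Suc (sample_sum X n \<omega>)" "real n * real_of_ereal (U \<omega>)"]
        by simp
      then show ?thesis
        using scale[OF zero_less_Suc n] below False by (simp add: upper_fails_def)
    qed
  qed
  define A where "A = {\<omega> \<in> space M. lower_fails \<gamma> n (\<delta> / 2) \<omega>}"
  define B where "B = {\<omega> \<in> space M. upper_fails \<gamma> n (\<delta> / 2) \<omega>}"
  have AB: "A \<in> events" "B \<in> events" unfolding A_def B_def by (rule lower_fails_event upper_fails_event)+
  \<comment> \<open>A union bound then finishes, each side contributing at most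
    \<open>\<delta> / 2\<close>.\<close>
  have "{\<omega> \<in> space M. L \<omega> < lam \<and> ereal lam < U \<omega>} = space M - (A \<union> B)"
    using lower upper by (auto simp: A_def B_def not_le[symmetric])
  then have "prob {\<omega> \<in> space M. L \<omega> < lam \<and> ereal lam < U \<omega>} = 1 - prob (A \<union> B)"
    using AB by (simp add: prob_compl)
  moreover have "prob (A \<union> B) \<le> prob A + prob B"
    using AB by (rule measure_Un_le)
  moreover have "prob A \<le> \<delta> / 2" "prob B \<le> \<delta> / 2"
    unfolding A_def B_def using \<gamma> n \<open>0 < \<delta>\<close> by (intro prob_lower_fails prob_upper_fails; simp)+
  ultimately show ?thesis by linarith
qed

end
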